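(* The structure $\mathsf{TLH}$ is a lower semilattice. For every pair of equivalence relations $E^{\mathrm{ce}}$ and $F^{\mathrm{ce}}$ on $\omega$ extending $=^{\mathrm{ce}}$, the meet (greatest lower bound) of $[E^{\mathrm{ce}}]_{\equiv_{\mathrm{Learn}}}$ and $[F^{\mathrm{ce}}]_{\equiv_{\mathrm{Learn}}}$ is $[E^{\mathrm{ce}}\cap F^{\mathrm{ce}}]_{\equiv_{\mathrm{Learn}}}$.
   Context: Fix a standard (acceptable) enumeration $(\varphi_e)_{e\in\omega}$ of the partial computable functions and let $W_e=\operatorname{dom}(\varphi_e)$. Write $e=^{\mathrm{ce}}e'$ iff $W_e=W_{e'}$. Let $\mathcal{R}^{\mathrm{ce}}$ be the set of all equivalence relations on $\omega$ extending $=^{\mathrm{ce}}$ (no definability or effectivity is assumed). An enumeration of a set $A$ is a surjection $\mu:\omega\to A$; $\mu[s]$ denotes the finite string $\mu(0),\dots,\mu(s-1)$. A learner is an arbitrary function $\mathbf{M}:\omega^{<\omega}\to\omega$ (no effectivity is assumed). For $E^{\mathrm{ce}}\in\mathcal{R}^{\mathrm{ce}}$, a family $\mathfrak{K}$ of nonempty c.e. sets is $E^{\mathrm{ce}}$-learnable if there is a learner $\mathbf{M}$ such that for every $e$ with $W_e\in\mathfrak{K}$ and every enumeration $\mu$ of $W_e$ there is $i\in\omega$ with $i\mathrel{E^{\mathrm{ce}}}e$ and $\mathbf{M}(\mu[s])=i$ for all sufficiently large $s$. $E^{\mathrm{ce}}\leq_{\mathrm{Learn}}F^{\mathrm{ce}}$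 means that every $E^{\mathrm{ce}}$-learnable family of nonempty c.e. sets is also $F^{\mathrm{ce}}$-learnable; $E^{\mathrm{ce}}\equiv_{\mathrm{Learn}}F^{\mathrm{ce}}$ means both $E^{\mathrm{ce}}\leq_{\mathrm{Learn}}F^{\mathrm{ce}}$ and $F^{\mathrm{ce}}\leq_{\mathrm{Learn}}E^{\mathrm{ce}}$. The tolerant learning hierarchy $\mathsf{TLH}$ is the poset $(\mathcal{E}^{\mathrm{ce}},\leq)$ where $\mathcal{E}^{\mathrm{ce}}=\mathcal{R}^{\mathrm{ce}}/{\equiv_{\mathrm{Learn}}}$ and $\leq$ is induced by $\leq_{\mathrm{Learn}}$. A lower semilattice is a poset in which any two elements have a greatest lower bound. *)

theory Defs
  imports "HOL-Algebra.Lattice"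
begin

section \<open>Partial computable functions\<close>

datatype recf = Zero | Succ | Proj nat | Comp recf "recf list" | Prec recf recf | Minim recf

text \<open>\<open>computes f xs y\<close>: the scheme \<open>f\<close> on input \<open>xs\<close> halts with output \<open>y\<close>. Schemes carry no
  arity; an ill-formed call (such as \<open>Proj i\<close> on at most \<open>i\<close> arguments) has no value. Recursion and
  minimisation act on the first argument.\<close>

inductive computes :: "recf \<Rightarrow> nat list \<Rightarrow> nat \<Rightarrow> bool" where
  zero: "computes Zero xs 0"
| succ: "computes Succ [x] (Suc x)"
| proj: "i < length xs \<Longrightarrow> computes (Proj i) xs (xs ! i)"
| comp: "list_all2 (\<lambda>g y. computes g xs y) gs ys \<Longrightarrow> computes f ys z \<Longrightarrow> computes (Comp f gs) xs z"
| prec_0: "computes f xs y \<Longrightarrow> computes (Prec f g) (0 # xs) y"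
| prec_Suc: "computes (Prec f g) (n # xs) r \<Longrightarrow> computes g (n # r # xs) y
    \<Longrightarrow> computes (Prec f g) (Suc n # xs) y"
| minim: "computes f (n # xs) 0 \<Longrightarrow> (\<forall>m<n. \<exists>k. computes f (m # xs) (Suc k))
    \<Longrightarrow> computes (Minim f) xs n"

definition partial_computable :: "nat \<Rightarrow> (nat list \<rightharpoonup> nat) \<Rightarrow> bool" where
  "partial_computable k \<psi> \<longleftrightarrow>
     (\<exists>f. \<forall>xs. length xs = k \<longrightarrow> (\<forall>y. \<psi> xs = Some y \<longleftrightarrow> computes f xs y))"

abbreviation partial_computable1 :: "(nat \<rightharpoonup> nat) \<Rightarrow> bool" where
  "partial_computable1 \<psi> \<equiv> partial_computable 1 (\<lambda>xs. \<psi> (xs ! 0))"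

abbreviation partial_computable2 :: "(nat \<Rightarrow> nat \<rightharpoonup> nat) \<Rightarrow> bool" where
  "partial_computable2 \<psi> \<equiv> partial_computable 2 (\<lambda>xs. \<psi> (xs ! 0) (xs ! 1))"

abbreviation total_computable :: "(nat \<Rightarrow> nat) \<Rightarrow> bool" where
  "total_computable t \<equiv> partial_computable1 (\<lambda>x. Some (t x))"

text \<open>Acceptable enumerations in the sense of Rogers: \<open>\<phi>\<close> lists exactly the unary partial computable
  functions, has a computable universal function, and every computable enumeration of partial
  computable functions translates computably into \<open>\<phi>\<close> (the s-m-n property).\<close>

definition acceptable :: "(nat \<Rightarrow> nat \<rightharpoonup> nat) \<Rightarrow> bool" where
  "acceptable \<phi> \<longleftrightarrow>
     range \<phi> = {\<psi>. partial_computable1 \<psi>} \<and>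
     partial_computable2 \<phi> \<and>
     (\<forall>\<psi>. partial_computable2 \<psi> \<longrightarrow> (\<exists>t. total_computable t \<and> (\<forall>e. \<phi> (t e) = \<psi> e)))"

section \<open>Learning up to an equivalence relation\<close>

text \<open>Everything below takes the fixed enumeration \<open>\<phi>\<close> as its first argument.\<close>

definition W :: "(nat \<Rightarrow> nat \<rightharpoonup> nat) \<Rightarrow> nat \<Rightarrow> nat set" where
  "W \<phi> e = dom (\<phi> e)"

definition eq_ce :: "(nat \<Rightarrow> nat \<rightharpoonup> nat) \<Rightarrow> nat rel" where
  "eq_ce \<phi> = {(e, e'). W \<phi> e = W \<phi> e'}"

definition R_ce :: "(nat \<Rightarrow> nat \<rightharpoonup> nat) \<Rightarrow> nat rel set" where
  "R_ce \<phi> = {E. equiv UNIV E \<and> eq_ce \<phi> \<subseteq> E}"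

definition enumerates :: "(nat \<Rightarrow> nat) \<Rightarrow> nat set \<Rightarrow> bool" where
  "enumerates \<mu> A \<longleftrightarrow> range \<mu> = A"

definition prefix_of :: "(nat \<Rightarrow> nat) \<Rightarrow> nat \<Rightarrow> nat list" where
  "prefix_of \<mu> s = map \<mu> [0..<s]"

definition ce_family :: "(nat \<Rightarrow> nat \<rightharpoonup> nat) \<Rightarrow> nat set set \<Rightarrow> bool" where
  "ce_family \<phi> K \<longleftrightarrow> (\<forall>A\<in>K. A \<noteq> {} \<and> A \<in> range (W \<phi>))"

definition learns :: "(nat \<Rightarrow> nat \<rightharpoonup> nat) \<Rightarrow> nat rel \<Rightarrow> (nat list \<Rightarrow> nat) \<Rightarrow> nat set set \<Rightarrow> bool" where
  "learns \<phi> E M K \<longleftrightarrow>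
     (\<forall>e \<mu>. W \<phi> e \<in> K \<longrightarrow> enumerates \<mu> (W \<phi> e) \<longrightarrow>
        (\<exists>i. (i, e) \<in> E \<and> (\<forall>\<^sub>F s in sequentially. M (prefix_of \<mu> s) = i)))"

definition learnable :: "(nat \<Rightarrow> nat \<rightharpoonup> nat) \<Rightarrow> nat rel \<Rightarrow> nat set set \<Rightarrow> bool" where
  "learnable \<phi> E K \<longleftrightarrow> ce_family \<phi> K \<and> (\<exists>M. learns \<phi> E M K)"

definition learn_le :: "(nat \<Rightarrow> nat \<rightharpoonup> nat) \<Rightarrow> nat rel \<Rightarrow> nat rel \<Rightarrow> bool" where
  "learn_le \<phi> E F \<longleftrightarrow> (\<forall>K. learnable \<phi> E K \<longrightarrow> learnable \<phi> F K)"

section \<open>The tolerant learning hierarchy\<close>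

definition learn_equiv :: "(nat \<Rightarrow> nat \<rightharpoonup> nat) \<Rightarrow> nat rel rel" where
  "learn_equiv \<phi> =
     {(E, F). E \<in> R_ce \<phi> \<and> F \<in> R_ce \<phi> \<and> learn_le \<phi> E F \<and> learn_le \<phi> F E}"

definition learn_class :: "(nat \<Rightarrow> nat \<rightharpoonup> nat) \<Rightarrow> nat rel \<Rightarrow> nat rel set" where
  "learn_class \<phi> E = learn_equiv \<phi> `` {E}"

definition TLH :: "(nat \<Rightarrow> nat \<rightharpoonup> nat) \<Rightarrow> nat rel set gorder" where
  "TLH \<phi> = \<lparr> carrier = R_ce \<phi> // learn_equiv \<phi>, eq = (=),
             le = (\<lambda>X Y. \<exists>E\<in>X. \<exists>F\<in>Y. learn_le \<phi> E F) \<rparr>"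

end

theory Submission
  imports Defs
begin

lemma learn_le_refl: "learn_le \<phi> E E"
  by (simp add: learn_le_def)

lemma learn_le_trans: "learn_le \<phi> E F \<Longrightarrow> learn_le \<phi> F G \<Longrightarrow> learn_le \<phi> E G"
  by (simp add: learn_le_def)

lemma R_ce_Int: "E \<in> R_ce \<phi> \<Longrightarrow> F \<in> R_ce \<phi> \<Longrightarrow> E \<inter> F \<in> R_ce \<phi>"
  by (auto simp: R_ce_def equiv_def refl_on_def intro: sym_Int trans_Int)

text \<open>The same learner works: passing to a coarser relation only enlarges the set of
  hypotheses that count as correct.\<close>

lemma learnable_mono:
  assumes "learnable \<phi> E K" "E \<subseteq> F"
  shows "learnable \<phi> F K"
  using assms unfolding learnable_def learns_def by blast

lemma learnable_Int:
  assumes E: "equiv UNIV E" and F: "equiv UNIV F"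
    and "learnable \<phi> E K" "learnable \<phi> F K"
  shows "learnable \<phi> (E \<inter> F) K"
proof -
  obtain M N where M: "learns \<phi> E M K" and N: "learns \<phi> F N K" and K: "ce_family \<phi> K"
    using assms by (auto simp: learnable_def)
  \<comment> \<open>If the learners settle on \<open>i E e\<close> and \<open>j F e\<close>, then \<open>e\<close> witnesses that the classes
    \<open>[i]\<^sub>E\<close> and \<open>[j]\<^sub>F\<close> meet, and every common element is \<open>E \<inter> F\<close>-equivalent to \<open>e\<close>; since
    learners need not be computable, one may be chosen freely.\<close>
  define common where "common i j = (SOME k. (k, i) \<in> E \<and> (k, j) \<in> F)" for i j
  have "learns \<phi> (E \<inter> F) (\<lambda>\<sigma>. common (M \<sigma>) (N \<sigma>)) K"
    unfolding learns_def
  proof (intro allI impI)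
    fix e \<mu> assume e: "W \<phi> e \<in> K" "enumerates \<mu> (W \<phi> e)"
    obtain i where i: "(i, e) \<in> E" "\<forall>\<^sub>F s in sequentially. M (prefix_of \<mu> s) = i"
      using M e unfolding learns_def by blast
    obtain j where j: "(j, e) \<in> F" "\<forall>\<^sub>F s in sequentially. N (prefix_of \<mu> s) = j"
      using N e unfolding learns_def by blast
    have "(e, i) \<in> E \<and> (e, j) \<in> F"
      using i(1) j(1) E F by (meson equiv_def symE)
    then have "(common i j, i) \<in> E \<and> (common i j, j) \<in> F"
      unfolding common_def by (rule someI)
    then have "(common i j, e) \<in> E \<inter> F"
      using i(1) j(1) E F by (meson IntI equiv_def transE)
    \<comment> \<open>The choice depends only on the pair \<open>(i, j)\<close>, so the combined
      learner is constant once both learners have settled. Before that the two classes may be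
      disjoint and the value arbitrary, which does no harm in the limit.\<close>
    moreover have
      "\<forall>\<^sub>F s in sequentially. common (M (prefix_of \<mu> s)) (N (prefix_of \<mu> s)) = common i j"
      using i(2) j(2) by eventually_elim simp
    ultimately show "\<exists>k. (k, e) \<in> E \<inter> F \<and>
        (\<forall>\<^sub>F s in sequentially. common (M (prefix_of \<mu> s)) (N (prefix_of \<mu> s)) = k)"
      by blast
  qed
  with K show ?thesis
    by (auto simp: learnable_def)
qed

text \<open>The families learnable for \<open>E \<inter> F\<close> are exactly those learnable for
  both \<open>E\<close> and \<open>F\<close>. This is the universal property of the meet, already at
  the level of the preorder on relations.\<close>

lemma learn_le_Int_iff:
  assumes "E \<in> R_ce \<phi>" "F \<in> R_ce \<phi>"
  shows "learn_le \<phi> G (E \<inter> F) \<longleftrightarrow> learn_le \<phi> G E \<and> learn_le \<phi> G F"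
proof -
  have "equiv UNIV E" "equiv UNIV F"
    using assms by (simp_all add: R_ce_def)
  then have "learnable \<phi> (E \<inter> F) K \<longleftrightarrow> learnable \<phi> E K \<and> learnable \<phi> F K" for K
    by (meson inf_le1 inf_le2 learnable_Int learnable_mono)
  then show ?thesis
    unfolding learn_le_def by blast
qed

lemma equiv_learn_equiv: "equiv (R_ce \<phi>) (learn_equiv \<phi>)"
proof (rule equivI)
  show "trans (learn_equiv \<phi>)"
    by (rule transI) (auto simp: learn_equiv_def dest: learn_le_trans)
qed (auto simp: learn_equiv_def learn_le_refl refl_on_def sym_def)

lemma carrier_TLH: "carrier (TLH \<phi>) = learn_class \<phi> ` R_ce \<phi>"
  by (auto simp: TLH_def learn_class_def quotient_def)

lemma eq_TLH: "x .=\<^bsub>TLH \<phi>\<^esub> y \<longleftrightarrow> x = y"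
  by (simp add: TLH_def)

lemma learn_class_eq_iff:
  assumes "E \<in> R_ce \<phi>" "F \<in> R_ce \<phi>"
  shows "learn_class \<phi> E = learn_class \<phi> F \<longleftrightarrow> learn_le \<phi> E F \<and> learn_le \<phi> F E"
  using eq_equiv_class_iff[OF equiv_learn_equiv assms] assms
  by (simp add: learn_class_def learn_equiv_def)

text \<open>The order on classes asks only for some pair of related representatives; transitivity
  carries the relation from that pair to \<open>E\<close> and \<open>F\<close>.\<close>

lemma le_TLH_learn_class:
  assumes "E \<in> R_ce \<phi>" "F \<in> R_ce \<phi>"
  shows "learn_class \<phi> E \<sqsubseteq>\<^bsub>TLH \<phi>\<^esub> learn_class \<phi> F \<longleftrightarrow> learn_le \<phi> E F"
proof
  assume "learn_class \<phi> E \<sqsubseteq>\<^bsub>TLH \<phi>\<^esub> learn_class \<phi> F"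
  then show "learn_le \<phi> E F"
    by (auto simp: TLH_def learn_class_def learn_equiv_def dest: learn_le_trans)
next
  assume "learn_le \<phi> E F"
  moreover have "E \<in> learn_class \<phi> E" "F \<in> learn_class \<phi> F"
    using assms by (simp_all add: learn_class_def learn_equiv_def learn_le_refl)
  ultimately show "learn_class \<phi> E \<sqsubseteq>\<^bsub>TLH \<phi>\<^esub> learn_class \<phi> F"
    by (auto simp: TLH_def)
qed

lemma partial_order_TLH: "partial_order (TLH \<phi>)"
proof
  show "(.=\<^bsub>TLH \<phi>\<^esub>) = (=)"
    by (simp add: TLH_def)
  \<comment> \<open>Antisymmetry is what the quotient provides: representatives that reduce to each
    other have the same class.\<close>
  show "x .=\<^bsub>TLH \<phi>\<^esub> y"
    if "x \<sqsubseteq>\<^bsub>TLH \<phi>\<^esub> y" "y \<sqsubseteq>\<^bsub>TLH \<phi>\<^esub> x" "x \<in> carrier (TLH \<phi>)" "y \<in> carrier (TLH \<phi>)" for x y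
    using that unfolding carrier_TLH eq_TLH
    by (elim imageE) (simp add: le_TLH_learn_class learn_class_eq_iff)
qed (auto simp: carrier_TLH eq_TLH le_TLH_learn_class learn_le_refl
       dest: learn_le_trans)

text \<open>Taking \<open>G = E \<inter> F\<close> in \<open>learn_le_Int_iff\<close> gives a lower
  bound; the converse direction, with \<open>G\<close> representing any other lower bound, makes it
  the greatest.\<close>

lemma is_glb_TLH_Int:
  assumes "E \<in> R_ce \<phi>" "F \<in> R_ce \<phi>"
  shows "is_glb (TLH \<phi>) (learn_class \<phi> (E \<inter> F)) {learn_class \<phi> E, learn_class \<phi> F}"
  using assms R_ce_Int[OF assms] learn_le_Int_iff[OF assms] learn_le_refl[of \<phi> "E \<inter> F"]
  by (auto simp: greatest_def Lower_def carrier_TLH le_TLH_learn_class)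

theorem corollary4p6:
  fixes \<phi> :: "nat \<Rightarrow> nat \<rightharpoonup> nat"
  assumes "acceptable \<phi>"
  shows "lower_semilattice (TLH \<phi>) \<and>
    (\<forall>E\<in>R_ce \<phi>. \<forall>F\<in>R_ce \<phi>.
       is_glb (TLH \<phi>) (learn_class \<phi> (E \<inter> F)) {learn_class \<phi> E, learn_class \<phi> F})"
proof
  interpret partial_order "TLH \<phi>"
    by (rule partial_order_TLH)
  show "lower_semilattice (TLH \<phi>)"
    \<comment> \<open>Any two elements of the carrier are classes of some \<open>E\<close> and
      \<open>F\<close>, so the class of \<open>E \<inter> F\<close> witnesses that a meet
      exists.\<close>
    by unfold_locales (auto simp: carrier_TLH dest: is_glb_TLH_Int)
qed (simp add: is_glb_TLH_Int)

end
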